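(* Let $\mathfrak{A}$ be an mp-residuated lattice. The pure filters of $\mathfrak{A}$ are precisely the sets of the form $\bigcap_{\mathfrak{m}\in Min(\mathfrak{A})\cap\mathcal{C}}\mathfrak{m}$, where $\mathcal{C}$ runs over the closed subsets of $Spec_{d}(\mathfrak{A})$.
   Context: A residuated lattice is an algebra $\mathfrak{A}=(A;\vee,\wedge,\odot,\rightarrow,0,1)$ such that $(A;\vee,\wedge,0,1)$ is a bounded lattice, $(A;\odot,1)$ is a commutative monoid, and $x\odot y\leq z$ iff $x\leq y\rightarrow z$ for all $x,y,z\in A$. A filter of $\mathfrak{A}$ is a non-empty subset $F\subseteq A$ with $x\odot y\in F$ for all $x,y\in F$, and $x\vee y\in F$ for all $x\in F$, $y\in A$. For filters $F,G$, $F\veebar G$ is the filter generated by $F\cup G$. A prime filter is a proper filter $\mathfrak{p}$ that is meet-irreducible among filters (equivalently, $x\vee y\in\mathfrak{p}$ implies $x\in\mathfrak{p}$ or $y\in\mathfrak{p}$); $Spec(\mathfrak{A})$ is the set of prime filters and $Min(\mathfrak{A})$ the set of inclusion-minimal prime filters. $\mathfrak{A}$ is mp if every prime filter contains a unique minimal prime filter. $Spec_{d}(\mathfrak{A})$ is $Spec(\mathfrak{A})$ with the dual hull-kernel topology, having the sets $h(x)=\{\mathfrak{p}\in Spec(\mathfrak{A})\mid x\in\mathfrak{p}\}$, $x\in A$, as an open basis. For $a\in A$, $a^{\perp}=\{b\in A\mid b\vee a=1\}$. For a filter $F$, $\sigma(F)$ is the intersection of all prime filters $\mathfrak{q}$ that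 are contained in some prime filter containing $F$; equivalently $\sigma(F)=\{a\in A\mid F\veebar a^{\perp}=A\}$. $F$ is pure if $\sigma(F)=F$. An empty intersection of filters is $A$. *)

theory Defs
  imports "HOL-Analysis.Abstract_Topology"
begin

text \<open>
  The universe of the residuated lattice is the whole type; the constants \<open>0\<close> and \<open>1\<close> of the
  signature are \<^const>\<open>bot\<close> and \<^const>\<open>top\<close>. The trivial algebra with \<open>0 = 1\<close> is allowed.
\<close>

class residuated_lattice = bounded_lattice +
  fixes odot :: "'a \<Rightarrow> 'a \<Rightarrow> 'a"  (infixl "\<odot>" 70)
    and residuum :: "'a \<Rightarrow> 'a \<Rightarrow> 'a"  (infixr "\<leadsto>" 60)
  assumes odot_assoc: "(x \<odot> y) \<odot> z = x \<odot> (y \<odot> z)"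
    and odot_commute: "x \<odot> y = y \<odot> x"
    and odot_top: "x \<odot> top = x"
    and residuation: "x \<odot> y \<le> z \<longleftrightarrow> x \<le> y \<leadsto> z"
begin

definition is_filter :: "'a set \<Rightarrow> bool" where
  "is_filter F \<longleftrightarrow> F \<noteq> {} \<and> (\<forall>x\<in>F. \<forall>y\<in>F. x \<odot> y \<in> F) \<and> (\<forall>x\<in>F. \<forall>y. sup x y \<in> F)"

definition prime_filter :: "'a set \<Rightarrow> bool" where
  "prime_filter P \<longleftrightarrow> is_filter P \<and> P \<noteq> UNIV \<and>
    (\<forall>F G. is_filter F \<longrightarrow> is_filter G \<longrightarrow> F \<inter> G = P \<longrightarrow> F = P \<or> G = P)"

definition Spec :: "'a set set" where
  "Spec = {P. prime_filter P}"

definition Min_Spec :: "'a set set" where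
  "Min_Spec = {M \<in> Spec. \<forall>Q\<in>Spec. Q \<subseteq> M \<longrightarrow> Q = M}"

definition hset :: "'a \<Rightarrow> 'a set set" where
  "hset x = {P \<in> Spec. x \<in> P}"

text \<open>The dual hull-kernel topology, given by its base of open sets; see \<open>openin_Spec_d\<close>.\<close>

definition Spec_d :: "'a set topology" where
  "Spec_d = topology (arbitrary union_of (\<lambda>U. U \<in> range hset))"

text \<open>An empty intersection is \<^term>\<open>UNIV\<close>, i.e. the whole algebra, as required.\<close>

definition sigma :: "'a set \<Rightarrow> 'a set" where
  "sigma F = \<Inter>{Q \<in> Spec. \<exists>P\<in>Spec. F \<subseteq> P \<and> Q \<subseteq> P}"

definition pure_filter :: "'a set \<Rightarrow> bool" where
  "pure_filter F \<longleftrightarrow> is_filter F \<and> sigma F = F"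

lemma odot_le: "x \<odot> y \<le> x"
proof -
  have "y \<odot> x \<le> x"
    by (metis odot_commute odot_top residuation order_refl order_trans top_greatest)
  then show ?thesis by (simp add: odot_commute)
qed

lemma is_filter_upward:
  assumes "is_filter F" "x \<in> F" "x \<le> y"
  shows "y \<in> F"
  using assms unfolding is_filter_def by (metis sup.absorb2)

lemma hset_odot: "hset x \<inter> hset y = hset (x \<odot> y)"
proof -
  have "x \<odot> y \<in> P \<longleftrightarrow> x \<in> P \<and> y \<in> P" if "P \<in> Spec" for P
  proof -
    have P: "is_filter P" using that by (simp add: Spec_def prime_filter_def)
    show ?thesis
      using P is_filter_upward[OF P] odot_le[of x y] odot_le[of y x] odot_commute[of x y]
      unfolding is_filter_def by metis
  qed
  then show ?thesis by (auto simp: hset_def)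
qed

lemma openin_Spec_d: "openin Spec_d = arbitrary union_of (\<lambda>U. U \<in> range hset)"
proof -
  have "istopology (arbitrary union_of (\<lambda>U. U \<in> range hset))"
    by (rule istopology_base) (auto simp: hset_odot)
  then show ?thesis by (simp add: Spec_d_def topology_inverse')
qed

lemma topspace_Spec_d: "topspace Spec_d = Spec"
proof
  show "topspace Spec_d \<subseteq> Spec"
    unfolding topspace_def openin_Spec_d union_of_def hset_def by auto
  have "top \<in> P" if "P \<in> Spec" for P
  proof -
    have P: "is_filter P" using that by (simp add: Spec_def prime_filter_def)
    then obtain x where "x \<in> P" by (auto simp: is_filter_def)
    then show ?thesis using is_filter_upward[OF P] top_greatest by blast
  qed
  then have "hset top = Spec" by (auto simp: hset_def)
  moreover have "openin Spec_d (hset top)"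
    unfolding openin_Spec_d by (rule arbitrary_union_of_inc) simp
  ultimately show "Spec \<subseteq> topspace Spec_d"
    using openin_subset by force
qed

end

class mp_residuated_lattice = residuated_lattice +
  assumes unique_Min_Spec: "P \<in> Spec \<Longrightarrow> \<exists>!M. M \<in> Min_Spec \<and> M \<subseteq> P"

end

theory Submission imports Defs begin

text \<open>
  Call two filters compatible if some prime filter contains both; by prime separation this means
  that no product of an element of one with an element of the other is \<open>0\<close>. The elements \<open>x\<close> with
  \<open>x \<odot> y = 0\<close> for some \<open>y \<in> F\<close> form an ideal, here \<open>annihilated F\<close>, and a filter \<open>Q\<close> is compatible
  with \<open>F\<close> iff it is disjoint from this ideal (\<open>disjoint_annihilated_iff\<close>). On the other hand, the
  closed sets of the dual hull-kernel topology are exactly the sets of primes that avoid some given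
  set of elements (\<open>closedin_Spec_d_iff\<close>). So the primes compatible with \<open>F\<close> form a closed set,
  and \<open>sigma F\<close> is by definition the intersection of this set. Since every prime contains a minimal
  one and closed sets are closed under passing to smaller primes, only the minimal members matter.
  This presents every pure filter as an intersection of the required form.

  For the converse, let \<open>C\<close> be closed, \<open>F\<close> the intersection of its minimal members, and \<open>M\<close> a
  minimal prime compatible with \<open>F\<close>. The claim is that \<open>M \<in> C\<close>, which gives \<open>F \<subseteq> sigma F\<close>; the
  other inclusion is clear, because \<open>F\<close> is an intersection of primes. The ideal \<open>annihilated M\<close> is
  disjoint from \<open>F\<close>. A compactness argument, carried out in \<open>closed_prime_avoiding_ideal\<close> as one
  more application of prime separation, then finds a single prime in \<open>C\<close> that avoids the whole
  ideal. A minimal prime \<open>M'\<close> below it lies in \<open>C\<close> and is compatible with \<open>M\<close>, so both lie in one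
  prime filter. The mp property forces \<open>M' = M\<close>.
\<close>

section \<open>Filters, ideals and prime separation\<close>

context residuated_lattice
begin

lemma sup_odot_le_iff: "sup x y \<odot> z \<le> u \<longleftrightarrow> x \<odot> z \<le> u \<and> y \<odot> z \<le> u"
  by (simp add: residuation)

lemma odot_le_right: "x \<odot> y \<le> y"
  using odot_le[of y x] by (simp add: odot_commute)

lemma odot_mono: "x \<le> x' \<Longrightarrow> y \<le> y' \<Longrightarrow> x \<odot> y \<le> x' \<odot> y'"
  by (metis odot_commute order_refl order_trans residuation)

lemma is_filterI:
  assumes "top \<in> F" "\<And>x y. x \<in> F \<Longrightarrow> y \<in> F \<Longrightarrow> x \<odot> y \<in> F"
    "\<And>x y. x \<in> F \<Longrightarrow> x \<le> y \<Longrightarrow> y \<in> F"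
  shows "is_filter F"
  using assms unfolding is_filter_def by (metis empty_iff sup_ge1)

lemma is_filter_odot: "is_filter F \<Longrightarrow> x \<in> F \<Longrightarrow> y \<in> F \<Longrightarrow> x \<odot> y \<in> F"
  by (simp add: is_filter_def)

lemma is_filter_top: "is_filter F \<Longrightarrow> top \<in> F"
  using is_filter_upward top_greatest unfolding is_filter_def by blast

lemma is_filter_Inter:
  assumes "\<And>F. F \<in> \<F> \<Longrightarrow> is_filter F"
  shows "is_filter (\<Inter>\<F>)"
proof (rule is_filterI)
  show "top \<in> \<Inter>\<F>" using assms is_filter_top by blast
next
  fix x y assume "x \<in> \<Inter>\<F>" "y \<in> \<Inter>\<F>"
  then show "x \<odot> y \<in> \<Inter>\<F>" using assms is_filter_odot by blast
next
  fix x y assume "x \<in> \<Inter>\<F>" "x \<le> y"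
  then show "y \<in> \<Inter>\<F>" using assms is_filter_upward by blast
qed

lemma Spec_is_filter: "P \<in> Spec \<Longrightarrow> is_filter P"
  by (simp add: Spec_def prime_filter_def)

lemma is_filter_bot: "is_filter F \<Longrightarrow> bot \<in> F \<Longrightarrow> F = UNIV"
  using is_filter_upward bot_least by blast

lemma Spec_bot: "P \<in> Spec \<Longrightarrow> bot \<notin> P"
  using is_filter_bot unfolding Spec_def prime_filter_def by blast

text \<open>
  The residual of a filter by an element is again a filter, because
  \<open>(z \<squnion> y) \<odot> (w \<squnion> y) \<le> (z \<odot> w) \<squnion> y\<close>.
\<close>

lemma is_filter_residual:
  assumes F: "is_filter F"
  shows "is_filter {z. sup z y \<in> F}"
proof (rule is_filterI)
  show "top \<in> {z. sup z y \<in> F}"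
    using is_filter_top[OF F] by (simp add: sup.absorb1)
next
  fix z w assume "z \<in> {z. sup z y \<in> F}" "w \<in> {z. sup z y \<in> F}"
  then have "sup z y \<odot> sup w y \<in> F"
    using is_filter_odot[OF F] by simp
  moreover have "sup z y \<odot> sup w y \<le> sup (z \<odot> w) y"
  proof -
    have "sup w y \<odot> z \<le> sup (z \<odot> w) y"
      by (simp add: sup_odot_le_iff odot_commute[of w z] odot_le le_supI2)
    moreover have "y \<odot> sup w y \<le> sup (z \<odot> w) y"
      by (simp add: odot_le le_supI2)
    ultimately show ?thesis
      by (simp add: sup_odot_le_iff odot_commute[of z "sup w y"])
  qed
  ultimately show "z \<odot> w \<in> {z. sup z y \<in> F}"
    using is_filter_upward[OF F] by blast
next
  fix z w assume "z \<in> {z. sup z y \<in> F}" "z \<le> w"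
  then show "w \<in> {z. sup z y \<in> F}"
    using is_filter_upward[OF F] sup_mono[OF _ order_refl] by blast
qed

text \<open>
  Meet-irreducibility is applied to the filters of all \<open>z\<close> with \<open>z \<squnion> y \<in> P\<close> and of all \<open>w\<close>
  whose join with every such \<open>z\<close> lies in \<open>P\<close>. An element of both satisfies \<open>z = z \<squnion> z \<in> P\<close>.
  With these residuals in place of the filters generated by \<open>P \<union> {x}\<close> and \<open>P \<union> {y}\<close>, no powers
  have to be estimated.
\<close>

lemma Spec_sup:
  assumes P: "P \<in> Spec" and xy: "sup x y \<in> P"
  shows "x \<in> P \<or> y \<in> P"
proof -
  let ?F = "{z. sup z y \<in> P}"
  let ?G = "\<Inter>((\<lambda>z. {w. sup w z \<in> P}) ` ?F)"
  have fP: "is_filter P" by (rule Spec_is_filter[OF P])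
  have "is_filter ?F" by (rule is_filter_residual[OF fP])
  moreover have "is_filter ?G"
    by (rule is_filter_Inter) (auto intro: is_filter_residual[OF fP])
  moreover have "?F \<inter> ?G = P"
  proof
    show "?F \<inter> ?G \<subseteq> P"
    proof
      fix z assume "z \<in> ?F \<inter> ?G"
      then have "sup z z \<in> P" by blast
      then show "z \<in> P" by simp
    qed
    show "P \<subseteq> ?F \<inter> ?G"
      using is_filter_upward[OF fP _ sup_ge1] by blast
  qed
  ultimately have "?F = P \<or> ?G = P"
    using P unfolding Spec_def prime_filter_def by blast
  moreover have "x \<in> ?F" "y \<in> ?G"
    using xy by (auto simp: sup_commute)
  ultimately show ?thesis by blast
qed

definition is_ideal :: "'a set \<Rightarrow> bool" where
  "is_ideal J \<longleftrightarrow> bot \<in> J \<and> (\<forall>x\<in>J. \<forall>y\<in>J. sup x y \<in> J) \<and> (\<forall>x\<in>J. \<forall>y. y \<le> x \<longrightarrow> y \<in> J)"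

lemma is_filter_Union_chain:
  assumes ne: "\<F> \<noteq> {}" and filters: "\<And>F. F \<in> \<F> \<Longrightarrow> is_filter F"
    and chain: "\<And>F G. F \<in> \<F> \<Longrightarrow> G \<in> \<F> \<Longrightarrow> F \<subseteq> G \<or> G \<subseteq> F"
  shows "is_filter (\<Union>\<F>)"
proof (rule is_filterI)
  show "top \<in> \<Union>\<F>" using ne filters is_filter_top by blast
next
  fix x y assume "x \<in> \<Union>\<F>" "y \<in> \<Union>\<F>"
  then obtain F G where FG: "F \<in> \<F>" "x \<in> F" "G \<in> \<F>" "y \<in> G" by blast
  then consider "y \<in> F" | "x \<in> G" using chain[of F G] by blast
  then show "x \<odot> y \<in> \<Union>\<F>"
    using FG filters is_filter_odot by cases blast+
next
  fix x y assume "x \<in> \<Union>\<F>" "x \<le> y"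
  then show "y \<in> \<Union>\<F>" using filters is_filter_upward by blast
qed

text \<open>
  A filter that is maximal among those disjoint from \<open>J\<close> is meet-irreducible: two strictly larger
  filters meet \<open>J\<close> in elements \<open>a\<close> and \<open>b\<close>, and \<open>a \<squnion> b\<close> is then in \<open>J\<close> and in both filters.
\<close>

lemma prime_separation:
  assumes G: "is_filter G" and J: "is_ideal J" and disj: "G \<inter> J = {}"
  obtains P where "P \<in> Spec" "G \<subseteq> P" "P \<inter> J = {}"
proof -
  let ?A = "{F. is_filter F \<and> G \<subseteq> F \<and> F \<inter> J = {}}"
  have "?A \<noteq> {}" using G disj by blast
  moreover have "\<Union>\<C> \<in> ?A" if ne: "\<C> \<noteq> {}" and chain: "subset.chain ?A \<C>" for \<C>
  proof -
    have sub: "\<C> \<subseteq> ?A" and lin: "\<And>X Y. X \<in> \<C> \<Longrightarrow> Y \<in> \<C> \<Longrightarrow> X \<subseteq> Y \<or> Y \<subseteq> X"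
      using chain unfolding subset_chain_def by blast+
    have "is_filter (\<Union>\<C>)"
      using is_filter_Union_chain[OF ne] sub lin by blast
    then show ?thesis using ne sub by blast
  qed
  ultimately have "\<exists>P\<in>?A. \<forall>F\<in>?A. P \<subseteq> F \<longrightarrow> F = P"
    by (rule subset_Zorn_nonempty)
  then obtain P where P: "P \<in> ?A" and max: "\<forall>F\<in>?A. P \<subseteq> F \<longrightarrow> F = P"
    by (rule bexE)
  have bigger: "\<exists>a\<in>F. a \<in> J" if "is_filter F" "P \<subseteq> F" "F \<noteq> P" for F
    using max P that by blast
  have "F = P \<or> H = P" if F: "is_filter F" and H: "is_filter H" and FH: "F \<inter> H = P" for F H
  proof (rule ccontr)
    assume "\<not> (F = P \<or> H = P)"
    then obtain a b where ab: "a \<in> F" "a \<in> J" "b \<in> H" "b \<in> J"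
      using bigger[OF F] bigger[OF H] FH by blast
    then have "sup a b \<in> F \<inter> H"
      using is_filter_upward[OF F _ sup_ge1] is_filter_upward[OF H _ sup_ge2] by blast
    moreover have "sup a b \<in> J" using J ab unfolding is_ideal_def by blast
    ultimately show False using FH P by blast
  qed
  moreover have "P \<noteq> UNIV" using P J unfolding is_ideal_def by blast
  ultimately have "P \<in> Spec" using P unfolding Spec_def prime_filter_def by blast
  then show ?thesis using that P by blast
qed

section \<open>Filters contained in a common prime filter\<close>

definition annihilated :: "'a set \<Rightarrow> 'a set" where
  "annihilated F = {x. \<exists>y\<in>F. x \<odot> y = bot}"

lemma is_ideal_annihilated:
  assumes F: "is_filter F"
  shows "is_ideal (annihilated F)"
  unfolding is_ideal_def
proof (intro conjI ballI allI impI)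
  show "bot \<in> annihilated F"
    using is_filter_top[OF F] odot_top unfolding annihilated_def by blast
next
  fix x x' assume "x \<in> annihilated F" "x' \<in> annihilated F"
  then obtain y y' where y: "y \<in> F" "x \<odot> y = bot" and y': "y' \<in> F" "x' \<odot> y' = bot"
    unfolding annihilated_def by blast
  have "x \<odot> (y \<odot> y') \<le> bot"
    using odot_mono[OF order_refl odot_le[of y y'], of x] y by simp
  moreover have "x' \<odot> (y \<odot> y') \<le> bot"
    using odot_mono[OF order_refl odot_le_right[of y y'], of x'] y' by simp
  ultimately have "sup x x' \<odot> (y \<odot> y') = bot"
    by (simp add: sup_odot_le_iff flip: bot_unique)
  then show "sup x x' \<in> annihilated F"
    using is_filter_odot[OF F y(1) y'(1)] unfolding annihilated_def by blast
next
  fix x z assume "x \<in> annihilated F" and zx: "z \<le> x"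
  then obtain y where y: "y \<in> F" "x \<odot> y = bot"
    unfolding annihilated_def by blast
  have "z \<odot> y = bot"
    using odot_mono[OF zx order_refl, of y] y(2) by (simp add: bot_unique)
  then show "z \<in> annihilated F"
    using y(1) unfolding annihilated_def by blast
qed

text \<open>
  Disjointness says that \<open>0\<close> is outside the filter generated by \<open>F \<union> G\<close>, which consists of the
  elements above some product \<open>f \<odot> g\<close>. Such a filter extends to a prime one.
\<close>

lemma disjoint_annihilated_iff:
  assumes F: "is_filter F" and G: "is_filter G"
  shows "G \<inter> annihilated F = {} \<longleftrightarrow> (\<exists>P\<in>Spec. F \<subseteq> P \<and> G \<subseteq> P)"
proof
  assume disj: "G \<inter> annihilated F = {}"
  let ?H = "{z. \<exists>f\<in>F. \<exists>g\<in>G. g \<odot> f \<le> z}"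
  have "is_filter ?H"
  proof (rule is_filterI)
    show "top \<in> ?H" using is_filter_top[OF F] is_filter_top[OF G] top_greatest by blast
  next
    fix z w assume "z \<in> ?H" "w \<in> ?H"
    then obtain f g f' g' where fg: "f \<in> F" "g \<in> G" "g \<odot> f \<le> z"
      and fg': "f' \<in> F" "g' \<in> G" "g' \<odot> f' \<le> w" by blast
    have "(g \<odot> g') \<odot> (f \<odot> f') = (g \<odot> f) \<odot> (g' \<odot> f')"
      by (metis odot_assoc odot_commute)
    then have "(g \<odot> g') \<odot> (f \<odot> f') \<le> z \<odot> w"
      using odot_mono[OF fg(3) fg'(3)] by simp
    then show "z \<odot> w \<in> ?H"
      using is_filter_odot[OF F fg(1) fg'(1)] is_filter_odot[OF G fg(2) fg'(2)] by blast
  next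
    fix z w assume "z \<in> ?H" "z \<le> w"
    then show "w \<in> ?H" using order_trans by blast
  qed
  moreover have "is_ideal {bot}"
    by (simp add: is_ideal_def bot_unique)
  moreover have "?H \<inter> {bot} = {}"
    using disj unfolding annihilated_def by (auto simp: bot_unique)
  ultimately obtain P where P: "P \<in> Spec" "?H \<subseteq> P"
    by (rule prime_separation)
  have FH: "F \<subseteq> ?H"
    using is_filter_top[OF G] odot_le_right by blast
  have GH: "G \<subseteq> ?H"
    using is_filter_top[OF F] odot_le by blast
  show "\<exists>P\<in>Spec. F \<subseteq> P \<and> G \<subseteq> P"
    using P(1) FH[THEN subset_trans, OF P(2)] GH[THEN subset_trans, OF P(2)] by blast
next
  assume "\<exists>P\<in>Spec. F \<subseteq> P \<and> G \<subseteq> P"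
  then obtain P where P: "P \<in> Spec" "F \<subseteq> P" "G \<subseteq> P" by blast
  have "x \<odot> y \<noteq> bot" if "x \<in> G" "y \<in> F" for x y
    using is_filter_odot[OF Spec_is_filter[OF P(1)] subsetD[OF P(3) that(1)] subsetD[OF P(2) that(2)]]
      Spec_bot[OF P(1)] by auto
  then show "G \<inter> annihilated F = {}"
    unfolding annihilated_def by blast
qed

section \<open>Closed sets of the dual hull-kernel topology\<close>

lemma closedin_Spec_d_iff: "closedin Spec_d C \<longleftrightarrow> (\<exists>S. C = {P \<in> Spec. P \<inter> S = {}})"
proof
  assume C: "closedin Spec_d C"
  then have "openin Spec_d (Spec - C)"
    by (simp add: closedin_def topspace_Spec_d)
  then obtain \<U> where \<U>: "\<U> \<subseteq> range hset" "\<Union>\<U> = Spec - C"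
    unfolding openin_Spec_d union_of_def by auto
  then obtain S where "\<U> = hset ` S" by (meson subset_imageE)
  moreover have "C \<subseteq> Spec" using closedin_subset[OF C] by (simp add: topspace_Spec_d)
  ultimately have "C = Spec - \<Union>(hset ` S)" using \<U>(2) by blast
  then have "C = {P \<in> Spec. P \<inter> S = {}}" by (auto simp: hset_def)
  then show "\<exists>S. C = {P \<in> Spec. P \<inter> S = {}}" ..
next
  assume "\<exists>S. C = {P \<in> Spec. P \<inter> S = {}}"
  then obtain S where S: "C = {P \<in> Spec. P \<inter> S = {}}" ..
  have "openin Spec_d (\<Union>(hset ` S))"
    unfolding openin_Spec_d by (auto intro: arbitrary_union_of_Union arbitrary_union_of_inc)
  moreover have "Spec - C = \<Union>(hset ` S)"
    unfolding S hset_def by blast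
  ultimately show "closedin Spec_d C"
    using S by (auto simp: closedin_def topspace_Spec_d)
qed

lemma closedin_Spec_d_down:
  "closedin Spec_d C \<Longrightarrow> P \<in> C \<Longrightarrow> Q \<in> Spec \<Longrightarrow> Q \<subseteq> P \<Longrightarrow> Q \<in> C"
  unfolding closedin_Spec_d_iff by blast

lemma closedin_primes_compatible:
  assumes F: "is_filter F"
  shows "closedin Spec_d {Q \<in> Spec. \<exists>P\<in>Spec. F \<subseteq> P \<and> Q \<subseteq> P}"
proof -
  have "{Q \<in> Spec. \<exists>P\<in>Spec. F \<subseteq> P \<and> Q \<subseteq> P} = {Q \<in> Spec. Q \<inter> annihilated F = {}}"
    using disjoint_annihilated_iff[OF F Spec_is_filter] by blast
  then show ?thesis unfolding closedin_Spec_d_iff by blast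
qed

text \<open>
  This is compactness of \<open>C\<close>: the sets \<open>hset k\<close> with \<open>k \<in> K\<close> form a directed family, since \<open>K\<close> is
  closed under joins, so if none of them covers \<open>C\<close>, then their union does not cover it either.
  The proof separates \<open>1\<close> from the ideal of all elements \<open>x\<close> such that \<open>C \<inter> hset x\<close> is contained
  in some \<open>hset k\<close>. This ideal contains \<open>K\<close> as well as every element that lies in no member of
  \<open>C\<close>. A prime that avoids all elements of the latter kind belongs to \<open>C\<close>, since \<open>C\<close> is closed.
\<close>

lemma closed_prime_avoiding_ideal:
  assumes C: "closedin Spec_d C" and K: "is_ideal K" and disj: "\<Inter>C \<inter> K = {}"
  obtains Q where "Q \<in> C" "Q \<inter> K = {}"
proof -
  obtain S where S: "C = {P \<in> Spec. P \<inter> S = {}}"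
    using C closedin_Spec_d_iff by blast
  let ?J = "{x. \<exists>k\<in>K. \<forall>P\<in>C. x \<in> P \<longrightarrow> k \<in> P}"
  have CS: "P \<in> Spec" if "P \<in> C" for P using that S by blast
  have "is_filter {top}"
    by (rule is_filterI) (auto simp: odot_top top_unique)
  moreover have "is_ideal ?J"
    unfolding is_ideal_def
  proof (intro conjI ballI allI impI)
    show "bot \<in> ?J" using K unfolding is_ideal_def by blast
  next
    fix x x' assume "x \<in> ?J" "x' \<in> ?J"
    then obtain k k' where k: "k \<in> K" "\<forall>P\<in>C. x \<in> P \<longrightarrow> k \<in> P"
      and k': "k' \<in> K" "\<forall>P\<in>C. x' \<in> P \<longrightarrow> k' \<in> P" by auto
    have "sup k k' \<in> P" if P: "P \<in> C" and "sup x x' \<in> P" for P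
    proof -
      have "k \<in> P \<or> k' \<in> P"
        using Spec_sup[OF CS[OF P] \<open>sup x x' \<in> P\<close>] k(2) k'(2) P by blast
      then show ?thesis
        using is_filter_upward[OF Spec_is_filter[OF CS[OF P]]] sup_ge1 sup_ge2 by blast
    qed
    moreover have "sup k k' \<in> K" using K k(1) k'(1) unfolding is_ideal_def by blast
    ultimately show "sup x x' \<in> ?J" by blast
  next
    fix x z assume "x \<in> ?J" and zx: "z \<le> x"
    then obtain k where k: "k \<in> K" "\<forall>P\<in>C. x \<in> P \<longrightarrow> k \<in> P" by auto
    moreover have "x \<in> P" if "P \<in> C" "z \<in> P" for P
      using is_filter_upward[OF Spec_is_filter[OF CS]] that zx by blast
    ultimately show "z \<in> ?J" by auto
  qed
  moreover have "{top} \<inter> ?J = {}"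
    using disj is_filter_top[OF Spec_is_filter[OF CS]] by blast
  ultimately obtain Q where Q: "Q \<in> Spec" "{top} \<subseteq> Q" "Q \<inter> ?J = {}"
    by (rule prime_separation)
  have "bot \<in> K" using K unfolding is_ideal_def by blast
  then have "S \<subseteq> ?J" using S by auto
  then have "Q \<inter> S = {}" using Q(3) by (meson disjoint_iff subsetD)
  then have "Q \<in> C" using Q(1) by (simp add: S)
  moreover have "K \<subseteq> ?J" by auto
  then have "Q \<inter> K = {}" using Q(3) by (meson disjoint_iff subsetD)
  ultimately show ?thesis by (rule that)
qed

end

section \<open>Pure filters in mp-residuated lattices\<close>

context mp_residuated_lattice
begin

lemma Inter_closed_eq_Inter_minimal:
  assumes C: "closedin Spec_d C"
  shows "\<Inter>C = \<Inter>(Min_Spec \<inter> C)"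
proof
  show "\<Inter>(Min_Spec \<inter> C) \<subseteq> \<Inter>C"
  proof (rule Inter_greatest)
    fix P assume P: "P \<in> C"
    then have "P \<in> Spec" using closedin_subset[OF C] topspace_Spec_d by blast
    then obtain M where "M \<in> Min_Spec" "M \<subseteq> P" using unique_Min_Spec by blast
    moreover from this have "M \<in> C"
      using closedin_Spec_d_down[OF C P] by (simp add: Min_Spec_def)
    ultimately show "\<Inter>(Min_Spec \<inter> C) \<subseteq> P" by blast
  qed
qed blast

text \<open>
  The minimal prime \<open>M'\<close> found in \<open>C\<close> shares with \<open>M\<close> an upper bound \<open>R\<close> in \<open>Spec\<close>. Uniqueness
  of the minimal prime below \<open>R\<close> identifies the two, so \<open>M\<close> inherits membership in \<open>C\<close>.
\<close>

lemma compatible_minimal_prime_in_closed: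
  assumes C: "closedin Spec_d C" and M: "M \<in> Min_Spec"
    and P: "P \<in> Spec" "\<Inter>C \<subseteq> P" "M \<subseteq> P"
  shows "M \<in> C"
proof -
  have CS: "C \<subseteq> Spec" using closedin_subset[OF C] by (simp add: topspace_Spec_d)
  have fM: "is_filter M" using M Spec_is_filter by (simp add: Min_Spec_def)
  have "is_filter (\<Inter>C)"
    by (rule is_filter_Inter) (use CS Spec_is_filter in blast)
  then have "\<Inter>C \<inter> annihilated M = {}"
    using P disjoint_annihilated_iff[OF fM] by blast
  then obtain Q where Q: "Q \<in> C" "Q \<inter> annihilated M = {}"
    using closed_prime_avoiding_ideal[OF C is_ideal_annihilated[OF fM]] by blast
  obtain M' where M': "M' \<in> Min_Spec" "M' \<subseteq> Q"
    using Q(1) CS unique_Min_Spec by blast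
  have "M' \<in> Spec" using M' by (simp add: Min_Spec_def)
  then obtain R where "R \<in> Spec" "M \<subseteq> R" "M' \<subseteq> R"
    using disjoint_annihilated_iff[OF fM Spec_is_filter] M'(2) Q(2) by blast
  then have "M = M'" using unique_Min_Spec[of R] M M'(1) by blast
  then show ?thesis
    using closedin_Spec_d_down[OF C Q(1) \<open>M' \<in> Spec\<close> M'(2)] by simp
qed

lemma pure_filter_Inter_closed:
  assumes C: "closedin Spec_d C"
  shows "pure_filter (\<Inter>C)"
proof -
  have CS: "C \<subseteq> Spec" using closedin_subset[OF C] by (simp add: topspace_Spec_d)
  have "is_filter (\<Inter>C)"
    by (rule is_filter_Inter) (use CS Spec_is_filter in blast)
  moreover have "sigma (\<Inter>C) \<subseteq> \<Inter>C"
    using CS unfolding sigma_def by blast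
  moreover have "\<Inter>C \<subseteq> Q" if Q: "Q \<in> Spec" and P: "P \<in> Spec" "\<Inter>C \<subseteq> P" "Q \<subseteq> P" for Q P
  proof -
    obtain M where M: "M \<in> Min_Spec" "M \<subseteq> Q" using unique_Min_Spec[OF Q] by blast
    have "M \<in> C"
      by (rule compatible_minimal_prime_in_closed[OF C M(1) P(1,2)]) (use M P in blast)
    then show ?thesis using M(2) by blast
  qed
  ultimately show ?thesis
    unfolding pure_filter_def sigma_def by blast
qed

end

theorem theorem4p8:
  "{F :: 'a::mp_residuated_lattice set. pure_filter F} =
    {\<Inter>(Min_Spec \<inter> C) | C. closedin Spec_d C}"
proof (intro Set.set_eqI iffI)
  fix F :: "'a set" assume "F \<in> {F. pure_filter F}"
  then have F: "is_filter F" and pure: "sigma F = F"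
    by (simp_all add: pure_filter_def)
  let ?C = "{Q \<in> Spec. \<exists>P\<in>Spec. F \<subseteq> P \<and> Q \<subseteq> P}"
  have C: "closedin Spec_d ?C" by (rule closedin_primes_compatible[OF F])
  have "F = \<Inter>(Min_Spec \<inter> ?C)"
    using pure Inter_closed_eq_Inter_minimal[OF C] unfolding sigma_def by (rule subst)
  with C show "F \<in> {\<Inter>(Min_Spec \<inter> C) | C. closedin Spec_d C}"
    by (intro CollectI exI conjI)
next
  fix F :: "'a set" assume "F \<in> {\<Inter>(Min_Spec \<inter> C) | C. closedin Spec_d C}"
  then obtain C :: "'a set set" where C: "closedin Spec_d C" and F: "F = \<Inter>(Min_Spec \<inter> C)"
    by (elim CollectE exE conjE)
  show "F \<in> {F. pure_filter F}"
    using pure_filter_Inter_closed[OF C] by (simp only: F Inter_closed_eq_Inter_minimal[OF C] mem_Collect_eq)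
qed

end
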